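(* Let $p$ be a prime. The map $\mathscr{S} : C(\mathbb{Z}_p,\mathbb{C}_p) \to C(\mathbb{Z}_p,\mathbb{C}_p)$ defined by $\mathscr{S}(\phi)(x) = \phi(x) - x\phi(x-1)$ is an automorphism of the $\mathbb{C}_p$-vector space $C(\mathbb{Z}_p,\mathbb{C}_p)$. If $\psi = \sum_{k=0}^\infty b_k\beta_k \in C(\mathbb{Z}_p,\mathbb{C}_p)$ (with $b_k \in \mathbb{C}_p$, $b_k \to 0$), then $$\mathscr{S}^{-1}(\psi) = \sum_{n=0}^\infty \left(\sum_{k=0}^n \frac{n!}{k!}\,b_k\right)\beta_n .$$
   Context: $C(\mathbb{Z}_p,\mathbb{C}_p)$ denotes the $\mathbb{C}_p$-vector space of continuous functions $\mathbb{Z}_p \to \mathbb{C}_p$. For $n \ge 0$, $\beta_n : \mathbb{Z}_p \to \mathbb{Z}_p$ is $\beta_n(x) = \binom{x}{n} = \frac{1}{n!}x(x-1)\cdots(x-n+1)$. By Mahler's theorem, every $\phi \in C(\mathbb{Z}_p,\mathbb{C}_p)$ is uniquely of the form $\sum_{n\ge0} b_n\beta_n$ with $b_n \in \mathbb{C}_p$, $b_n \to 0$ (the $b_n$ are the Mahler coefficients), and all such series define continuous functions. *)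

theory Defs
  imports "HOL-Analysis.Analysis" "HOL-Computational_Algebra.Computational_Algebra"
begin

text \<open>
  The libraries contain no p-adic numbers.  The field of complex p-adic numbers is by definition a
  completion of an algebraic closure of the completion of the rationals for the p-adic absolute
  value, and as such it is determined up to isometric isomorphism.  This definition is stated here
  as a predicate on a type \<open>'k\<close> that is both a field and a metric space; all intermediate fields
  are found inside \<open>'k\<close>.  The class \<open>real_normed_field\<close> cannot be used, since such a field
  contains the reals with their usual absolute value.
\<close>

definition padic_abs_rat :: "nat \<Rightarrow> rat \<Rightarrow> real" where
  "padic_abs_rat p r =
     (case quotient_of r of (a, b) \<Rightarrow>
        if a = 0 then 0
        else real p powi (int (multiplicity (int p) b) - int (multiplicity (int p) a)))"

definition absval :: "'k::{field_char_0,metric_space} \<Rightarrow> real" where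
  "absval x = dist x 0"

text \<open>In a complete field the closure of the rationals is their completion.\<close>

definition Qp :: "'k::{field_char_0,metric_space} set" where
  "Qp = closure (range of_rat)"

definition Zp :: "'k::{field_char_0,metric_space} set" where
  "Zp = {x \<in> Qp. absval x \<le> 1}"

definition Qp_bar :: "'k::{field_char_0,metric_space} set" where
  "Qp_bar = {x. \<exists>P. P \<noteq> 0 \<and> (\<forall>i. coeff P i \<in> Qp) \<and> poly P x = 0}"

definition is_Cp :: "nat \<Rightarrow> 'k::{field_char_0,metric_space} itself \<Rightarrow> bool" where
  "is_Cp p T \<longleftrightarrow>
     (\<forall>x y :: 'k. dist x y = absval (x - y)) \<and>
     (\<forall>x y :: 'k. absval (x * y) = absval x * absval y) \<and>
     (\<forall>x y :: 'k. absval (x + y) \<le> max (absval x) (absval y)) \<and>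
     (\<forall>r. absval (of_rat r :: 'k) = padic_abs_rat p r) \<and>
     (\<forall>P :: 'k poly. (\<forall>i. coeff P i \<in> Qp_bar) \<and> degree P > 0 \<longrightarrow> (\<exists>x\<in>Qp_bar. poly P x = 0)) \<and>
     closure (Qp_bar :: 'k set) = UNIV \<and>
     complete (UNIV :: 'k set)"

text \<open>
  A function on \<open>Zp\<close> is represented by the function on \<open>'k\<close> that is \<open>undefined\<close> outside \<open>Zp\<close>, so
  that equality in \<open>CZp\<close> is equality on \<open>Zp\<close>.
\<close>

definition CZp :: "('k \<Rightarrow> 'k::{field_char_0,metric_space}) set" where
  "CZp = {f \<in> extensional Zp. continuous_on Zp f}"

definition CZp_add :: "('k \<Rightarrow> 'k) \<Rightarrow> ('k \<Rightarrow> 'k) \<Rightarrow> 'k \<Rightarrow> 'k::{field_char_0,metric_space}" where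
  "CZp_add f g = (\<lambda>x\<in>Zp. f x + g x)"

definition CZp_scale :: "'k \<Rightarrow> ('k \<Rightarrow> 'k) \<Rightarrow> 'k \<Rightarrow> 'k::{field_char_0,metric_space}" where
  "CZp_scale c f = (\<lambda>x\<in>Zp. c * f x)"

definition CZp_automorphism ::
    "(('k \<Rightarrow> 'k) \<Rightarrow> ('k \<Rightarrow> 'k::{field_char_0,metric_space})) \<Rightarrow> bool" where
  "CZp_automorphism T \<longleftrightarrow>
     bij_betw T CZp CZp \<and>
     (\<forall>f\<in>CZp. \<forall>g\<in>CZp. T (CZp_add f g) = CZp_add (T f) (T g)) \<and>
     (\<forall>c. \<forall>f\<in>CZp. T (CZp_scale c f) = CZp_scale c (T f))"

text \<open>
  \<open>f\<close> is the sum of the series with terms \<open>b n * (x gchoose n)\<close>, and \<open>b\<close> tends to zero.  Binomial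
  coefficients have absolute value at most 1 on \<open>Zp\<close>, so the latter condition makes pointwise
  convergence uniform.
\<close>

definition mahler_series ::
    "(nat \<Rightarrow> 'k) \<Rightarrow> ('k \<Rightarrow> 'k::{field_char_0,metric_space}) \<Rightarrow> bool" where
  "mahler_series b f \<longleftrightarrow>
     b \<longlonglongrightarrow> 0 \<and> (\<forall>x\<in>Zp. (\<lambda>n. b n * (x gchoose n)) sums f x)"

definition S_map :: "('k \<Rightarrow> 'k) \<Rightarrow> 'k \<Rightarrow> 'k::{field_char_0,metric_space}" where
  "S_map \<phi> = (\<lambda>x\<in>Zp. \<phi> x - x * \<phi> (x - 1))"

end

theory Submission
  imports Defs
begin

text \<open>
  Write \<open>S\<close> for the operator. Both its injectivity and its surjectivity come from reading
  \<open>S \<phi> = \<psi>\<close> as the recursion \<open>\<phi> x = \<psi> x + x * \<phi> (x - 1)\<close>. At the natural numbers the factor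
  \<open>x\<close> stops the recursion at \<open>0\<close>, so that \<open>\<psi>\<close> determines \<open>\<phi>\<close> there, and hence everywhere on
  \<open>Zp\<close>, where the natural numbers are dense (\<open>inj_on_S_map\<close>). Conversely, unrolling the recursion
  indefinitely suggests
  \<open>\<phi> x = (\<Sum>n. x * (x - 1) * \<dots> * (x - n + 1) * \<psi> (x - n))\<close>.
  The falling factorial is \<open>n! * (x gchoose n)\<close>; here \<open>n!\<close> tends to zero, the binomial coefficient
  lies in the unit ball, and \<open>\<psi>\<close> is bounded because \<open>Zp\<close> is compact. In a complete ultrametric
  field this makes the series converge uniformly, so that \<open>\<phi>\<close> is continuous
  (\<open>S_map_preimage\<close>).

  For the coefficients, \<open>x * (x - 1 gchoose n) = (n + 1) * (x gchoose (n + 1))\<close> shows that \<open>S\<close>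
  maps the series with coefficients \<open>a n\<close> to the one with coefficients \<open>a n - n * a (n - 1)\<close>
  (\<open>mahler_series_S_map\<close>). The sums \<open>a n = (\<Sum>k\<le>n. n! / k! * b k)\<close> solve
  \<open>a n - n * a (n - 1) = b n\<close> and tend to zero with \<open>b\<close> (\<open>sum_fact_ratio_tendsto_0\<close>), so they
  define a continuous function; \<open>S\<close> maps it to \<open>\<psi>\<close>, and by injectivity it is the inverse image.
\<close>

section \<open>Analysis over a complete ultrametric field\<close>

text \<open>
  An absolute value that extends the p-adic one is incompatible with \<open>real_normed_field\<close>, and being
  given by a hypothesis it cannot instantiate a class of topological rings either. Continuity of the
  field operations and the resulting rules for series are therefore derived here from the axioms of
  an ultrametric absolute value. The parameter \<open>T\<close> serves only to fix the type \<open>'k\<close>.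
\<close>
locale ultrametric_field =
  fixes T :: "'k::{field_char_0,metric_space} itself"
  assumes dist_absval: "dist (x::'k) y = absval (x - y)"
    and absval_mult: "absval ((x::'k) * y) = absval x * absval y"
    and absval_add: "absval ((x::'k) + y) \<le> max (absval x) (absval y)"
    and complete_UNIV: "complete (UNIV :: 'k set)"
begin

lemma absval_nonneg: "0 \<le> absval (x::'k)"
  by (simp add: absval_def)

lemma absval_0: "absval (0::'k) = 0"
  by (simp add: absval_def)

lemma absval_eq_0_iff: "absval (x::'k) = 0 \<longleftrightarrow> x = 0"
  by (simp add: absval_def)

lemma absval_1: "absval (1::'k) = 1"
  using absval_mult[of 1 1] absval_eq_0_iff[of 1] by simp

lemma absval_minus: "absval (- (x::'k)) = absval x"
  using dist_absval[of 0 x] dist_absval[of x 0] by (simp add: dist_commute)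

lemma absval_diff_commute: "absval ((x::'k) - y) = absval (y - x)"
  using absval_minus[of "x - y"] by simp

lemma absval_diff: "absval ((x::'k) - y) \<le> max (absval x) (absval y)"
  using absval_add[of x "- y"] by (simp add: absval_minus)

lemma absval_divide: "absval ((x::'k) / y) = absval x / absval y"
proof (cases "y = 0")
  case True
  then show ?thesis by (simp add: absval_0)
next
  case False
  then show ?thesis
    using absval_mult[of "x / y" y] by (simp add: absval_eq_0_iff field_simps)
qed

lemma absval_sum_le:
  assumes "0 \<le> B" "\<And>i. i \<in> A \<Longrightarrow> absval (f i :: 'k) \<le> B"
  shows "absval (sum f A) \<le> B"
  using assms(2)
proof (induction A rule: infinite_finite_induct)
  case (insert a A)
  have "absval (sum f (insert a A)) \<le> max (absval (f a)) (absval (sum f A))"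
    using insert.hyps by (simp add: absval_add)
  also have "\<dots> \<le> B"
    using insert by auto
  finally show ?case .
qed (auto simp: absval_0 assms)

lemma tendsto_absval_iff:
  "(f \<longlongrightarrow> (l::'k)) F \<longleftrightarrow> ((\<lambda>x. absval (f x - l)) \<longlongrightarrow> 0) F"
  using tendsto_dist_iff[of f l F] by (simp add: dist_absval)

lemma tendsto_minus_absval:
  fixes f g :: "'b \<Rightarrow> 'k"
  assumes "(f \<longlongrightarrow> l) F" "(g \<longlongrightarrow> m) F"
  shows "((\<lambda>x. f x - g x) \<longlongrightarrow> l - m) F"
  unfolding tendsto_absval_iff
proof (rule tendsto_sandwich[OF _ _ tendsto_const])
  show "((\<lambda>x. absval (f x - l) + absval (g x - m)) \<longlongrightarrow> 0) F"
    using tendsto_add[OF assms[unfolded tendsto_absval_iff]] by simp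
  show "\<forall>\<^sub>F x in F. absval (f x - g x - (l - m)) \<le> absval (f x - l) + absval (g x - m)"
  proof (rule always_eventually, rule allI)
    fix x
    have "absval (f x - g x - (l - m)) = absval ((f x - l) - (g x - m))"
      by (simp add: algebra_simps)
    also have "\<dots> \<le> absval (f x - l) + absval (g x - m)"
      using absval_diff[of "f x - l" "g x - m"] absval_nonneg[of "f x - l"]
        absval_nonneg[of "g x - m"] by linarith
    finally show "absval (f x - g x - (l - m)) \<le> absval (f x - l) + absval (g x - m)" .
  qed
qed (simp add: absval_nonneg)

lemma tendsto_plus_absval:
  fixes f g :: "'b \<Rightarrow> 'k"
  assumes "(f \<longlongrightarrow> l) F" "(g \<longlongrightarrow> m) F"
  shows "((\<lambda>x. f x + g x) \<longlongrightarrow> l + m) F"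
  using tendsto_minus_absval[OF assms(1) tendsto_minus_absval[OF tendsto_const[of 0] assms(2)]]
  by simp

lemma tendsto_times_absval:
  fixes f g :: "'b \<Rightarrow> 'k"
  assumes "(f \<longlongrightarrow> l) F" "(g \<longlongrightarrow> m) F"
  shows "((\<lambda>x. f x * g x) \<longlongrightarrow> l * m) F"
  unfolding tendsto_absval_iff
proof (rule tendsto_sandwich[OF _ _ tendsto_const])
  let ?bound = "\<lambda>x. absval (f x - l) * absval (g x - m)
      + absval (f x - l) * absval m + absval l * absval (g x - m)"
  note f0 = assms(1)[unfolded tendsto_absval_iff] and g0 = assms(2)[unfolded tendsto_absval_iff]
  show "(?bound \<longlongrightarrow> 0) F"
    using tendsto_add[OF tendsto_add[OF tendsto_mult[OF f0 g0]
          tendsto_mult[OF f0 tendsto_const[of "absval m"]]]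
        tendsto_mult[OF tendsto_const[of "absval l"] g0]] by simp
  show "\<forall>\<^sub>F x in F. absval (f x * g x - l * m) \<le> ?bound x"
  proof (rule always_eventually, rule allI)
    fix x
    have "f x * g x - l * m = (f x - l) * (g x - m) + (f x - l) * m + l * (g x - m)"
      by (simp add: algebra_simps)
    then show "absval (f x * g x - l * m) \<le> ?bound x"
      using absval_add[of "(f x - l) * (g x - m) + (f x - l) * m" "l * (g x - m)"]
        absval_add[of "(f x - l) * (g x - m)" "(f x - l) * m"]
        absval_nonneg[of "(f x - l) * (g x - m)"] absval_nonneg[of "(f x - l) * m"]
        absval_nonneg[of "l * (g x - m)"]
      by (simp add: absval_mult)
  qed
qed (simp add: absval_nonneg)

lemma continuous_on_minus_absval:
  fixes f g :: "'b::topological_space \<Rightarrow> 'k"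
  assumes "continuous_on A f" "continuous_on A g"
  shows "continuous_on A (\<lambda>x. f x - g x)"
  using assms by (auto simp: continuous_on_def intro!: tendsto_minus_absval)

lemma continuous_on_plus_absval:
  fixes f g :: "'b::topological_space \<Rightarrow> 'k"
  assumes "continuous_on A f" "continuous_on A g"
  shows "continuous_on A (\<lambda>x. f x + g x)"
  using assms by (auto simp: continuous_on_def intro!: tendsto_plus_absval)

lemma continuous_on_times_absval:
  fixes f g :: "'b::topological_space \<Rightarrow> 'k"
  assumes "continuous_on A f" "continuous_on A g"
  shows "continuous_on A (\<lambda>x. f x * g x)"
  using assms by (auto simp: continuous_on_def intro!: tendsto_times_absval)

lemma continuous_on_sum_absval:
  fixes f :: "'i \<Rightarrow> 'b::topological_space \<Rightarrow> 'k"
  assumes "\<And>i. i \<in> I \<Longrightarrow> continuous_on A (f i)"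
  shows "continuous_on A (\<lambda>x. \<Sum>i\<in>I. f i x)"
  using assms by (induction I rule: infinite_finite_induct) (auto intro!: continuous_on_plus_absval)

lemma sums_diff_absval:
  assumes "f sums (s::'k)" "g sums t"
  shows "(\<lambda>n. f n - g n) sums (s - t)"
  using tendsto_minus_absval[OF assms[unfolded sums_def]] by (simp add: sums_def sum_subtractf)

lemma sums_mult_absval:
  assumes "f sums (s::'k)"
  shows "(\<lambda>n. c * f n) sums (c * s)"
  using tendsto_times_absval[OF tendsto_const[of c] assms[unfolded sums_def]]
  by (simp add: sums_def sum_distrib_left)

lemma sums_Suc_absval:
  assumes "(\<lambda>n. f (Suc n)) sums (s::'k)"
  shows "f sums (f 0 + s)"
proof -
  have "(\<lambda>n. f 0 + (\<Sum>i<n. f (Suc i))) \<longlonglongrightarrow> f 0 + s"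
    using tendsto_plus_absval[OF tendsto_const[of "f 0"] assms[unfolded sums_def]] .
  then have "(\<lambda>n. \<Sum>i<Suc n. f i) \<longlonglongrightarrow> f 0 + s"
    by (simp add: sum.lessThan_Suc_shift del: sum.lessThan_Suc)
  then show ?thesis
    unfolding sums_def by (rule LIMSEQ_imp_Suc)
qed

lemma sums_tail_le:
  assumes "f sums (s::'k)" and B: "\<And>n. N \<le> n \<Longrightarrow> absval (f n) \<le> B"
  shows "absval (s - (\<Sum>n<N. f n)) \<le> B"
proof (rule field_le_epsilon)
  fix e :: real
  assume "0 < e"
  have B0: "0 \<le> B"
    using B[of N] absval_nonneg[of "f N"] by simp
  have "\<forall>\<^sub>F M in sequentially. dist (\<Sum>n<M. f n) s < e"
    using assms(1) \<open>0 < e\<close> unfolding sums_def by (rule tendstoD)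
  then obtain M where M: "\<And>m. M \<le> m \<Longrightarrow> dist (\<Sum>n<m. f n) s < e"
    unfolding eventually_sequentially by blast
  define m where "m = max M N"
  have "absval (\<Sum>n\<in>{N..<m}. f n) \<le> B"
    by (rule absval_sum_le) (auto simp: B B0)
  moreover have "absval (s - (\<Sum>n<m. f n)) < e"
    using M[of m] by (simp add: m_def dist_absval absval_diff_commute)
  ultimately have "absval ((s - (\<Sum>n<m. f n)) + (\<Sum>n\<in>{N..<m}. f n)) \<le> B + e"
    using absval_add[of "s - (\<Sum>n<m. f n)" "\<Sum>n\<in>{N..<m}. f n"] B0 \<open>0 < e\<close> by linarith
  moreover have "(\<Sum>n<m. f n) = (\<Sum>n<N. f n) + (\<Sum>n\<in>{N..<m}. f n)"
    unfolding lessThan_atLeast0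
    by (rule sum.atLeastLessThan_concat[symmetric]) (auto simp: m_def)
  then have "(s - (\<Sum>n<m. f n)) + (\<Sum>n\<in>{N..<m}. f n) = s - (\<Sum>n<N. f n)"
    by (simp add: algebra_simps)
  ultimately show "absval (s - (\<Sum>n<N. f n)) \<le> B + e"
    by (simp only:)
qed

text \<open>
  The ultrametric inequality bounds a block of terms by its largest one, so that the partial sums
  are Cauchy as soon as the terms tend to zero.
\<close>
lemma sums_exist_if_tendsto_0:
  assumes "f \<longlonglongrightarrow> (0::'k)"
  shows "\<exists>s. f sums s"
proof -
  have "Cauchy (\<lambda>n. \<Sum>i<n. f i)"
  proof (rule metric_CauchyI)
    fix e :: real
    assume "0 < e"
    then have "\<forall>\<^sub>F n in sequentially. dist (f n) 0 < e / 2"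
      by (intro tendstoD[OF assms]) simp
    then obtain N where N: "\<And>n. N \<le> n \<Longrightarrow> absval (f n) < e / 2"
      unfolding eventually_sequentially absval_def by blast
    have le: "dist (\<Sum>i<m. f i) (\<Sum>i<n. f i) < e" if "N \<le> m" "m \<le> n" for m n
    proof -
      have "(\<Sum>i<n. f i) = (\<Sum>i<m. f i) + (\<Sum>i\<in>{m..<n}. f i)"
        unfolding lessThan_atLeast0
        by (rule sum.atLeastLessThan_concat[symmetric]) (use that in auto)
      then have "dist (\<Sum>i<m. f i) (\<Sum>i<n. f i) = absval (\<Sum>i\<in>{m..<n}. f i)"
        by (simp add: dist_absval absval_minus)
      also have "\<dots> \<le> e / 2"
        by (rule absval_sum_le) (use \<open>0 < e\<close> N that in \<open>auto intro: less_imp_le\<close>)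
      finally show ?thesis
        using \<open>0 < e\<close> by simp
    qed
    show "\<exists>M. \<forall>m\<ge>M. \<forall>n\<ge>M. dist (\<Sum>i<m. f i) (\<Sum>i<n. f i) < e"
    proof (intro exI allI impI)
      fix m n
      assume "N \<le> m" "N \<le> n"
      then show "dist (\<Sum>i<m. f i) (\<Sum>i<n. f i) < e"
        using le[of m n] le[of n m] by (cases "m \<le> n") (auto simp: dist_commute)
    qed
  qed
  then obtain s where "(\<lambda>n. \<Sum>i<n. f i) \<longlonglongrightarrow> s"
    using complete_UNIV unfolding complete_def by blast
  then show ?thesis
    by (auto simp: sums_def)
qed

lemma tendsto_0_if_absval_le:
  fixes f :: "nat \<Rightarrow> 'k"
  assumes "\<And>n. absval (f n) \<le> B n" "B \<longlonglongrightarrow> 0"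
  shows "f \<longlonglongrightarrow> 0"
  unfolding tendsto_absval_iff
  by (rule tendsto_sandwich[OF _ _ tendsto_const assms(2)]) (auto simp: absval_nonneg assms(1))

text \<open>
  The ultrametric form of Weierstrass' test: a partial sum differs from the limit by no more than
  the largest bound on an omitted term, and these bounds tend to zero.
\<close>
lemma continuous_on_sums:
  fixes f :: "nat \<Rightarrow> 'b::topological_space \<Rightarrow> 'k"
  assumes cont: "\<And>n. continuous_on A (f n)"
    and le: "\<And>n x. x \<in> A \<Longrightarrow> absval (f n x) \<le> B n" and B: "B \<longlonglongrightarrow> 0"
    and sums: "\<And>x. x \<in> A \<Longrightarrow> (\<lambda>n. f n x) sums g x"
  shows "continuous_on A g"
proof (rule uniform_limit_theorem)
  show "\<forall>\<^sub>F N in sequentially. continuous_on A (\<lambda>x. \<Sum>n<N. f n x)"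
    by (intro always_eventually allI continuous_on_sum_absval cont)
  show "uniform_limit A (\<lambda>N x. \<Sum>n<N. f n x) g sequentially"
  proof (rule uniform_limitI)
    fix e :: real
    assume "0 < e"
    then have "\<forall>\<^sub>F n in sequentially. dist (B n) 0 < e / 2"
      by (intro tendstoD[OF B]) simp
    then obtain N where N: "\<And>n. N \<le> n \<Longrightarrow> \<bar>B n\<bar> < e / 2"
      unfolding eventually_sequentially by (auto simp: dist_real_def)
    have "dist (\<Sum>n<M. f n x) (g x) < e" if "N \<le> M" "x \<in> A" for M x
    proof -
      have "absval (f n x) \<le> e / 2" if "M \<le> n" for n
        using le[OF \<open>x \<in> A\<close>, of n] N[of n] that \<open>N \<le> M\<close> by linarith
      then have "absval (g x - (\<Sum>n<M. f n x)) \<le> e / 2"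
        by (rule sums_tail_le[OF sums[OF \<open>x \<in> A\<close>]])
      then show ?thesis
        using \<open>0 < e\<close> by (simp add: dist_absval absval_diff_commute)
    qed
    then show "\<forall>\<^sub>F M in sequentially. \<forall>x\<in>A. dist (\<Sum>n<M. f n x) (g x) < e"
      unfolding eventually_sequentially by blast
  qed
qed simp

end

section \<open>The p-adic integers\<close>

lemma padic_abs_rat_of_int:
  "a \<noteq> 0 \<Longrightarrow> padic_abs_rat p (of_int a) = inverse (real p) ^ multiplicity (int p) a"
  by (simp add: padic_abs_rat_def power_int_minus power_inverse)

locale padic_field = ultrametric_field T
  for T :: "'k::{field_char_0,metric_space} itself" +
  fixes p :: nat
  assumes prime: "prime p"
    and absval_of_rat: "absval (of_rat r :: 'k) = padic_abs_rat p r"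
begin

lemma absval_of_int_le:
  assumes "int p ^ N dvd a"
  shows "absval (of_int a :: 'k) \<le> inverse (real p) ^ N"
proof (cases "a = 0")
  case True
  then show ?thesis by (simp add: absval_0)
next
  case False
  have "absval (of_int a :: 'k) = inverse (real p) ^ multiplicity (int p) a"
    using absval_of_rat[of "of_int a"] False by (simp add: padic_abs_rat_of_int)
  also have "\<dots> \<le> inverse (real p) ^ N"
  proof (rule power_decreasing)
    show "N \<le> multiplicity (int p) a"
      using False prime assms
      by (intro multiplicity_geI) (auto simp: prime_nat_iff)
    show "inverse (real p) \<le> 1"
      using prime_gt_0_nat[OF prime] by (simp add: inverse_le_1_iff)
  qed simp
  finally show ?thesis .
qed

lemma absval_of_nat_le:
  assumes "p ^ N dvd n"
  shows "absval (of_nat n :: 'k) \<le> inverse (real p) ^ N"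
  using absval_of_int_le[of N "int n"] assms by (simp flip: of_nat_power)

lemma absval_of_nat_le_1: "absval (of_nat n :: 'k) \<le> 1"
  using absval_of_nat_le[of 0 n] by simp

lemma absval_of_int_coprime:
  assumes "\<not> int p dvd b"
  shows "absval (of_int b :: 'k) = 1"
proof -
  have "b \<noteq> 0" using assms by auto
  then show ?thesis
    using absval_of_rat[of "of_int b"] assms
    by (simp add: padic_abs_rat_of_int not_dvd_imp_multiplicity_0)
qed

lemma inverse_power_tendsto_0: "(\<lambda>N. inverse (real p) ^ N) \<longlonglongrightarrow> 0"
  by (rule LIMSEQ_power_zero)
    (use prime_gt_1_nat[OF prime] in \<open>simp add: inverse_less_1_iff\<close>)

lemma inverse_power_less:
  assumes "0 < e"
  obtains N where "inverse (real p) ^ N < e"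
  using LIMSEQ_D[OF inverse_power_tendsto_0 assms] by auto

lemma absval_fact_tendsto_0: "(\<lambda>n. absval (fact n :: 'k)) \<longlonglongrightarrow> 0"
proof (rule LIMSEQ_I)
  fix e :: real
  assume "0 < e"
  then obtain N where N: "inverse (real p) ^ N < e"
    by (rule inverse_power_less)
  have "absval (fact n :: 'k) < e" if "p ^ N \<le> n" for n
  proof -
    have "p ^ N dvd fact n"
      by (rule dvd_fact) (use that prime_gt_0_nat[OF prime] in \<open>auto simp: Suc_le_eq\<close>)
    then have "absval (of_nat (fact n) :: 'k) \<le> inverse (real p) ^ N"
      by (rule absval_of_nat_le)
    then show ?thesis
      using N by simp
  qed
  then show "\<exists>M. \<forall>n\<ge>M. norm (absval (fact n :: 'k) - 0) < e"
    using absval_nonneg by auto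
qed

lemma absval_fact_pos: "0 < absval (fact n :: 'k)"
  using absval_nonneg[of "fact n"] absval_eq_0_iff[of "fact n"] by (simp add: less_le)

lemma Qp_diff:
  assumes "(x::'k) \<in> Qp" "y \<in> Qp"
  shows "x - y \<in> Qp"
  unfolding Qp_def closure_approachable
proof (intro allI impI)
  fix e :: real
  assume "0 < e"
  obtain r s where rs: "dist (of_rat r) x < e" "dist (of_rat s) y < e"
    using assms \<open>0 < e\<close> unfolding Qp_def closure_approachable by fast
  have "dist (of_rat (r - s)) (x - y) = absval ((of_rat r - x) - (of_rat s - y))"
    by (simp add: dist_absval of_rat_diff algebra_simps)
  also have "\<dots> < e"
    using absval_diff[of "of_rat r - x" "of_rat s - y"] rs by (simp add: dist_absval)
  finally show "\<exists>z\<in>range of_rat. dist z (x - y) < e" by blast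
qed

lemma Zp_diff: "(x::'k) \<in> Zp \<Longrightarrow> y \<in> Zp \<Longrightarrow> x - y \<in> Zp"
  unfolding Zp_def using absval_diff[of x y] by (auto intro: Qp_diff)

lemma of_nat_in_Zp: "(of_nat n :: 'k) \<in> Zp"
proof -
  have "(of_rat (of_nat n) :: 'k) \<in> Qp"
    unfolding Qp_def by (rule subsetD[OF closure_subset rangeI])
  then show ?thesis
    by (simp add: Zp_def absval_of_nat_le_1)
qed

lemma Zp_minus_1: "(x::'k) \<in> Zp \<Longrightarrow> x - 1 \<in> Zp"
  using Zp_diff[of x 1] of_nat_in_Zp[of 1] by simp

text \<open>
  A rational number in the unit ball has a denominator prime to \<open>p\<close>, which can be inverted modulo
  \<open>p ^ N\<close>. This yields the density of the natural numbers and, since \<open>m\<close> ranges over a finite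
  set, the total boundedness of \<open>Zp\<close>.
\<close>
lemma Zp_near_residue:
  assumes "(x::'k) \<in> Zp"
  obtains m where "m < p ^ N" "dist x (of_nat m) \<le> inverse (real p) ^ N"
proof -
  have ppos: "0 < p" by (rule prime_gt_0_nat[OF prime])
  define e where "e = inverse (real p) ^ N"
  have e: "0 < e" "e \<le> 1"
    using ppos by (auto simp: e_def inverse_le_1_iff intro!: power_le_one)
  obtain r where r: "dist (of_rat r) x < e"
    using assms e unfolding Zp_def Qp_def closure_approachable by fast
  obtain a b where ab: "quotient_of r = (a, b)" by (cases "quotient_of r")
  have b: "b > 0" "coprime a b" and r_eq: "r = of_int a / of_int b"
    using quotient_of_denom_pos[OF ab] quotient_of_coprime[OF ab] quotient_of_div[OF ab] by auto
  have "absval (of_rat r :: 'k) \<le> max (absval (of_rat r - x)) (absval x)"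
    using absval_add[of "of_rat r - x" x] by simp
  also have "\<dots> \<le> 1"
    using r e assms by (simp add: dist_absval Zp_def)
  finally have r1: "padic_abs_rat p r \<le> 1"
    by (simp add: absval_of_rat)
  have pb: "\<not> int p dvd b"
  proof
    assume pb: "int p dvd b"
    then have "\<not> int p dvd a"
      using b prime coprime_common_divisor[of a b "int p"]
      by (auto simp: prime_nat_iff)
    then have ma: "multiplicity (int p) a = 0" "a \<noteq> 0"
      by (auto simp: not_dvd_imp_multiplicity_0)
    have "1 \<le> multiplicity (int p) b"
      using pb b prime by (intro multiplicity_geI) (auto simp: prime_nat_iff)
    then have "real p ^ 1 \<le> real p ^ multiplicity (int p) b"
      using ppos by (intro power_increasing) auto
    moreover have "1 < real p"
      using prime_gt_1_nat[OF prime] by simp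
    ultimately have "1 < real p ^ multiplicity (int p) b"
      unfolding power_one_right by (rule less_le_trans[rotated])
    then show False
      using r1 ab ma by (simp add: padic_abs_rat_def)
  qed
  have "coprime b (int p ^ N)"
    using pb prime prime_imp_coprime[of "int p" b] by (simp add: coprime_commute)
  then obtain u v where uv: "u * b + v * int p ^ N = 1"
    using bezout_int[of b "int p ^ N"] by auto
  define m where "m = nat ((u * a) mod (int p ^ N))"
  have m: "int m = (u * a) mod (int p ^ N)"
    using ppos by (simp add: m_def)
  have "m < p ^ N"
  proof -
    have "int m < int (p ^ N)"
      using ppos by (simp add: m)
    then show ?thesis by linarith
  qed
  moreover have "dist x (of_nat m) \<le> e"
  proof -
    have "int p ^ N dvd u * a - int m"
      by (simp add: m dvd_minus_mod)
    then obtain w where "u * a - int m = int p ^ N * w" by (rule dvdE)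
    then have mw: "int m = u * a - int p ^ N * w" by simp
    have "a - int m * b = a * (u * b + v * int p ^ N) - int m * b"
      by (simp add: uv)
    also have "\<dots> = int p ^ N * (a * v + w * b)"
      by (simp add: mw algebra_simps)
    finally have dvd: "int p ^ N dvd a - int m * b" by simp
    have "(of_rat r :: 'k) - of_nat m = of_int (a - int m * b) / of_int b"
      using b by (simp add: r_eq of_rat_divide field_simps)
    then have "absval ((of_rat r :: 'k) - of_nat m) \<le> e"
      using absval_of_int_le[OF dvd] by (simp add: absval_divide absval_of_int_coprime[OF pb] e_def)
    moreover have "absval (x - of_rat r) \<le> e"
      using r by (simp add: dist_absval absval_diff_commute)
    ultimately show ?thesis
      using absval_add[of "x - of_rat r" "of_rat r - of_nat m"] by (simp add: dist_absval)
  qed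
  ultimately show ?thesis
    using that by (simp add: e_def)
qed

lemma nat_dense_in_Zp:
  assumes "(x::'k) \<in> Zp" "0 < e"
  obtains m where "dist x (of_nat m) < e"
proof -
  obtain N where "inverse (real p) ^ N < e"
    using inverse_power_less[OF assms(2)] .
  then show ?thesis
    using Zp_near_residue[OF assms(1), of N] that by (meson le_less_trans)
qed

lemma compact_Zp: "compact (Zp :: 'k set)"
  unfolding compact_eq_totally_bounded
proof (intro conjI allI impI)
  have "(Zp :: 'k set) = Qp \<inter> cball 0 1"
    by (auto simp: Zp_def absval_def dist_commute)
  moreover have "closed (Qp \<inter> cball 0 1 :: 'k set)"
    by (simp add: Qp_def closed_Int)
  ultimately show "complete (Zp :: 'k set)"
    using complete_Int_closed[OF complete_UNIV, of "Qp \<inter> cball 0 1"] by simp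
next
  fix e :: real
  assume "0 < e"
  then obtain N where N: "inverse (real p) ^ N < e"
    by (rule inverse_power_less)
  have "x \<in> (\<Union>c\<in>of_nat ` {..<p ^ N}. ball c e)" if x: "x \<in> Zp" for x :: 'k
  proof -
    obtain m where "m < p ^ N" "dist x (of_nat m) \<le> inverse (real p) ^ N"
      using Zp_near_residue[OF x, of N] by blast
    then show ?thesis
      using N by (auto simp: dist_commute intro!: bexI[of _ m])
  qed
  then show "\<exists>K. finite K \<and> Zp \<subseteq> (\<Union>c::'k\<in>K. ball c e)"
    by (intro exI[of _ "of_nat ` {..<p ^ N}"]) auto
qed

lemma CZp_bounded:
  assumes "(f :: 'k \<Rightarrow> 'k) \<in> CZp"
  obtains B where "0 \<le> B" "\<And>x. x \<in> Zp \<Longrightarrow> absval (f x) \<le> B"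
proof -
  have "bounded (f ` Zp)"
    using assms by (auto simp: CZp_def intro!: compact_imp_bounded compact_continuous_image compact_Zp)
  then obtain B where B: "\<And>x. x \<in> Zp \<Longrightarrow> absval (f x) \<le> B"
    unfolding bounded_any_center[of _ 0] absval_def by (auto simp: dist_commute)
  moreover have "0 \<le> B"
    using B[OF of_nat_in_Zp[of 0]] absval_nonneg[of "f (of_nat 0)"] by simp
  ultimately show ?thesis using that by blast
qed

section \<open>Binomial coefficients on the p-adic integers\<close>

text \<open>
  All factors lie in the unit ball, so replacing \<open>x\<close> by \<open>y\<close> in one factor after the other costs at
  most \<open>absval (x - y)\<close> each time, and ultrametrically the costs do not add up.
\<close>
lemma absval_falling_factorial_diff_le:
  assumes "(x::'k) \<in> Zp" "y \<in> Zp"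
  shows "absval ((\<Prod>i<n. x - of_nat i) - (\<Prod>i<n. y - of_nat i)) \<le> absval (x - y)"
proof (induction n)
  case 0
  then show ?case by (simp add: absval_0 absval_nonneg)
next
  case (Suc n)
  have le1: "absval (z - of_nat i) \<le> 1" if "z \<in> Zp" for z :: 'k and i
    using Zp_diff[OF that of_nat_in_Zp[of i]] by (simp add: Zp_def)
  have prod1: "absval (\<Prod>i<n. y - of_nat i) \<le> 1"
    by (induction n) (auto simp: absval_1 absval_mult absval_nonneg le1[OF assms(2)] intro!: mult_le_one)
  let ?P = "\<Prod>i<n. x - of_nat i" and ?Q = "\<Prod>i<n. y - of_nat i"
  have "(\<Prod>i<Suc n. x - of_nat i) - (\<Prod>i<Suc n. y - of_nat i)
      = (?P - ?Q) * (x - of_nat n) + ?Q * (x - y)"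
    by (simp add: algebra_simps)
  moreover have "absval ((?P - ?Q) * (x - of_nat n)) \<le> absval (x - y)"
    using mult_mono[OF Suc.IH le1[OF assms(1), of n] absval_nonneg absval_nonneg]
    by (simp add: absval_mult)
  moreover have "absval (?Q * (x - y)) \<le> absval (x - y)"
    using mult_right_mono[OF prod1 absval_nonneg[of "x - y"]] by (simp add: absval_mult)
  ultimately show ?case
    using absval_add[of "(?P - ?Q) * (x - of_nat n)" "?Q * (x - y)"] by simp
qed

lemma absval_gbinomial_diff_le:
  assumes "(x::'k) \<in> Zp" "y \<in> Zp"
  shows "absval ((x gchoose n) - (y gchoose n)) \<le> absval (x - y) / absval (fact n :: 'k)"
proof -
  have "(x gchoose n) - (y gchoose n)
      = ((\<Prod>i<n. x - of_nat i) - (\<Prod>i<n. y - of_nat i)) / fact n"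
    by (simp add: gbinomial_prod_rev diff_divide_distrib lessThan_atLeast0)
  then show ?thesis
    using absval_falling_factorial_diff_le[OF assms, of n] absval_fact_pos[of n]
    by (simp add: absval_divide divide_right_mono)
qed

lemma continuous_on_gbinomial: "continuous_on Zp (\<lambda>x::'k. x gchoose n)"
  unfolding continuous_on_iff
proof (intro ballI allI impI)
  fix x :: 'k and e :: real
  assume x: "x \<in> Zp" and "0 < e"
  have "dist (y gchoose n) (x gchoose n) < e"
    if y: "y \<in> Zp" and d: "dist y x < e * absval (fact n :: 'k)" for y
  proof -
    have "absval (y - x) / absval (fact n :: 'k) < e"
      using d absval_fact_pos[of n] by (simp add: dist_absval pos_divide_less_eq)
    then show ?thesis
      using absval_gbinomial_diff_le[OF y x, of n] by (simp add: dist_absval)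
  qed
  then show "\<exists>d>0. \<forall>y\<in>Zp. dist y x < d \<longrightarrow> dist (y gchoose n) (x gchoose n) < e"
    using \<open>0 < e\<close> absval_fact_pos[of n] by (intro exI[of _ "e * absval (fact n :: 'k)"]) auto
qed

text \<open>
  On the natural numbers binomial coefficients are natural numbers, hence in the unit ball, and a
  natural number close to \<open>x\<close> changes the binomial coefficient by at most 1.
\<close>
lemma absval_gbinomial_le_1:
  assumes "(x::'k) \<in> Zp"
  shows "absval (x gchoose n) \<le> 1"
proof -
  obtain m where m: "dist x (of_nat m) < absval (fact n :: 'k)"
    using nat_dense_in_Zp[OF assms absval_fact_pos] .
  have "absval (x - of_nat m) / absval (fact n :: 'k) \<le> 1"
    using m absval_fact_pos[of n] by (simp add: dist_absval)
  then have "absval ((x gchoose n) - (of_nat m gchoose n)) \<le> 1"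
    using absval_gbinomial_diff_le[OF assms of_nat_in_Zp[of m], of n] by linarith
  moreover have "absval (of_nat m gchoose n :: 'k) \<le> 1"
    using absval_of_nat_le_1[of "m choose n"] by (simp add: binomial_gbinomial)
  ultimately show ?thesis
    using absval_add[of "(x gchoose n) - (of_nat m gchoose n)" "of_nat m gchoose n"] by simp
qed

section \<open>The operator and its inverse\<close>

lemma CZp_ext:
  assumes "f \<in> CZp" "g \<in> CZp" "\<And>x::'k. x \<in> Zp \<Longrightarrow> f x = g x"
  shows "f = g"
  using assms by (auto simp: CZp_def intro: extensionalityI)

lemma continuous_on_shift:
  assumes "(f :: 'k \<Rightarrow> 'k) \<in> CZp"
  shows "continuous_on Zp (\<lambda>x. f (x - of_nat n))"
proof (rule continuous_on_compose2[of Zp f])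
  show "continuous_on Zp f" using assms by (simp add: CZp_def)
  show "continuous_on Zp (\<lambda>x::'k. x - of_nat n)"
    by (intro continuous_on_minus_absval continuous_on_id continuous_on_const)
  show "(\<lambda>x. x - of_nat n) ` Zp \<subseteq> (Zp :: 'k set)"
    by (auto intro: Zp_diff of_nat_in_Zp)
qed

lemma S_map_in_CZp:
  assumes "(f :: 'k \<Rightarrow> 'k) \<in> CZp"
  shows "S_map f \<in> CZp"
proof -
  have "continuous_on Zp (\<lambda>x. f x - x * f (x - 1))"
    using assms continuous_on_shift[OF assms, of 1]
    by (intro continuous_on_minus_absval continuous_on_times_absval continuous_on_id)
      (auto simp: CZp_def)
  then have "continuous_on Zp (S_map f)"
    by (rule continuous_on_eq) (simp add: S_map_def)
  then show ?thesis
    by (simp add: CZp_def S_map_def)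
qed

text \<open>
  The functional equation determines a function on the natural numbers, where the recursion starts
  by itself because the factor \<open>x\<close> vanishes at \<open>0\<close>; the natural numbers are dense.
\<close>
lemma inj_on_S_map: "inj_on S_map (CZp :: ('k \<Rightarrow> 'k) set)"
proof (rule inj_onI)
  fix f g :: "'k \<Rightarrow> 'k"
  assume f: "f \<in> CZp" and g: "g \<in> CZp" and eq: "S_map f = S_map g"
  have rec: "f x - x * f (x - 1) = g x - x * g (x - 1)" if "x \<in> Zp" for x
    using fun_cong[OF eq, of x] that by (simp add: S_map_def)
  have nat: "f (of_nat n) = g (of_nat n)" for n
  proof (induction n)
    case 0
    then show ?case using rec[OF of_nat_in_Zp[of 0]] by simp
  next
    case (Suc n)
    then show ?case using rec[OF of_nat_in_Zp[of "Suc n"]] by simp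
  qed
  have cont: "continuous_on Zp (\<lambda>x. f x - g x)"
    using f g by (auto simp: CZp_def intro!: continuous_on_minus_absval)
  show "f = g"
  proof (rule CZp_ext[OF f g], rule ccontr)
    fix x :: 'k
    assume x: "x \<in> Zp" and "f x \<noteq> g x"
    then have "0 < absval (f x - g x)"
      using absval_nonneg[of "f x - g x"] absval_eq_0_iff[of "f x - g x"] by (simp add: less_le)
    then obtain d where "0 < d"
      and d: "\<And>y. y \<in> Zp \<Longrightarrow> dist y x < d \<Longrightarrow> dist (f y - g y) (f x - g x) < absval (f x - g x)"
      using cont x unfolding continuous_on_iff by blast
    obtain m where "dist x (of_nat m) < d"
      using nat_dense_in_Zp[OF x \<open>0 < d\<close>] .
    then have "dist (0::'k) (f x - g x) < absval (f x - g x)"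
      using d[OF of_nat_in_Zp[of m]] nat[of m] by (simp add: dist_commute)
    then show False
      by (simp add: absval_def dist_commute)
  qed
qed

text \<open>
  Iterating \<open>\<phi> x = \<psi> x + x * \<phi> (x - 1)\<close> produces the series of the terms
  \<open>x * (x - 1) * \<dots> * (x - n + 1) * \<psi> (x - n)\<close>. It converges uniformly since \<open>\<psi>\<close> is bounded and
  the falling factorial is \<open>n!\<close> times a binomial coefficient.
\<close>
lemma S_map_preimage:
  assumes "(\<psi> :: 'k \<Rightarrow> 'k) \<in> CZp"
  shows "\<exists>\<phi>\<in>CZp. S_map \<phi> = \<psi>"
proof -
  obtain B where B: "0 \<le> B" "\<And>x. x \<in> Zp \<Longrightarrow> absval (\<psi> x) \<le> B"
    using CZp_bounded[OF assms] by blast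
  define t :: "nat \<Rightarrow> 'k \<Rightarrow> 'k"
    where "t = (\<lambda>n x. fact n * (x gchoose n) * \<psi> (x - of_nat n))"
  have t_le: "absval (t n x) \<le> absval (fact n :: 'k) * B" if x: "x \<in> Zp" for n x
  proof -
    have "absval (x gchoose n) * absval (\<psi> (x - of_nat n)) \<le> 1 * B"
      by (intro mult_mono absval_gbinomial_le_1 B Zp_diff of_nat_in_Zp x absval_nonneg) simp
    then show ?thesis
      unfolding t_def absval_mult mult.assoc mult_1 by (rule mult_left_mono[OF _ absval_nonneg])
  qed
  have t_lim: "(\<lambda>n. absval (fact n :: 'k) * B) \<longlonglongrightarrow> 0"
    using tendsto_mult_right[OF absval_fact_tendsto_0, of B] by simp
  have "\<exists>s. (\<lambda>n. t n x) sums s" if "x \<in> Zp" for x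
    by (intro sums_exist_if_tendsto_0 tendsto_0_if_absval_le[OF _ t_lim] t_le that)
  then obtain h where h: "\<And>x. x \<in> Zp \<Longrightarrow> (\<lambda>n. t n x) sums h x"
    by metis
  define \<phi> where "\<phi> = restrict h Zp"
  have \<phi>: "(\<lambda>n. t n x) sums \<phi> x" if "x \<in> Zp" for x
    using h that by (simp add: \<phi>_def)
  have "continuous_on Zp (t n)" for n
    unfolding t_def
    by (intro continuous_on_times_absval continuous_on_const continuous_on_gbinomial
        continuous_on_shift assms)
  then have "continuous_on Zp \<phi>"
    using t_le t_lim \<phi> by (rule continuous_on_sums)
  then have mem: "\<phi> \<in> CZp"
    by (simp add: CZp_def \<phi>_def)
  have "S_map \<phi> x = \<psi> x" if x: "x \<in> Zp" for x
  proof -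
    have "t (Suc n) x = x * t n (x - 1)" for n
    proof -
      have "t (Suc n) x = fact n * (of_nat (Suc n) * (x gchoose Suc n)) * \<psi> (x - of_nat (Suc n))"
        by (simp add: t_def mult_ac)
      also have "of_nat (Suc n) * (x gchoose Suc n) = x * (x - 1 gchoose n)"
        by (rule gbinomial_absorption)
      finally show ?thesis
        by (simp add: t_def mult_ac diff_diff_eq)
    qed
    then have "(\<lambda>n. t (Suc n) x) sums (x * \<phi> (x - 1))"
      using sums_mult_absval[OF \<phi>[OF Zp_minus_1[OF x]], of x] by simp
    then have "(\<lambda>n. t n x) sums (t 0 x + x * \<phi> (x - 1))"
      by (rule sums_Suc_absval)
    then have "\<phi> x = t 0 x + x * \<phi> (x - 1)"
      using \<phi>[OF x] sums_unique2 by blast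
    then show ?thesis
      using x by (simp add: S_map_def t_def)
  qed
  then have "S_map \<phi> = \<psi>"
    by (rule CZp_ext[OF S_map_in_CZp[OF mem] assms])
  with mem show ?thesis by blast
qed

lemma S_map_automorphism: "CZp_automorphism (S_map :: ('k \<Rightarrow> 'k) \<Rightarrow> 'k \<Rightarrow> 'k)"
  unfolding CZp_automorphism_def
proof (intro conjI ballI allI)
  show "bij_betw S_map CZp (CZp :: ('k \<Rightarrow> 'k) set)"
    unfolding bij_betw_def using inj_on_S_map S_map_in_CZp S_map_preimage by blast
  show "S_map (CZp_add f g) = CZp_add (S_map f) (S_map g)" for f g :: "'k \<Rightarrow> 'k"
    by (rule ext) (auto simp: S_map_def CZp_add_def restrict_def Zp_minus_1 algebra_simps)
  show "S_map (CZp_scale c f) = CZp_scale c (S_map f)" for c and f :: "'k \<Rightarrow> 'k"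
    by (rule ext) (auto simp: S_map_def CZp_scale_def restrict_def Zp_minus_1 algebra_simps)
qed

section \<open>Mahler coefficients of the inverse\<close>

lemma mahler_series_exists:
  assumes "a \<longlonglongrightarrow> (0::'k)"
  obtains f where "f \<in> CZp" "mahler_series a f"
proof -
  have a0: "(\<lambda>n. absval (a n)) \<longlonglongrightarrow> 0"
    using assms by (simp add: tendsto_absval_iff[of a])
  have le: "absval (a n * (x gchoose n)) \<le> absval (a n)" if "x \<in> Zp" for n x
    using mult_left_le[OF absval_gbinomial_le_1[OF that] absval_nonneg] by (simp add: absval_mult)
  have "\<exists>s. (\<lambda>n. a n * (x gchoose n)) sums s" if "x \<in> Zp" for x
    by (intro sums_exist_if_tendsto_0 tendsto_0_if_absval_le[OF _ a0] le that)
  then obtain h where h: "\<And>x. x \<in> Zp \<Longrightarrow> (\<lambda>n. a n * (x gchoose n)) sums h x"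
    by metis
  have "continuous_on Zp h"
  proof (rule continuous_on_sums[OF _ le a0 h])
    show "continuous_on Zp (\<lambda>x. a n * (x gchoose n))" for n
      by (intro continuous_on_times_absval continuous_on_const continuous_on_gbinomial)
  qed
  then have "continuous_on Zp (restrict h Zp)"
    by (rule continuous_on_eq) simp
  then have "restrict h Zp \<in> CZp"
    by (simp add: CZp_def)
  moreover have "mahler_series a (restrict h Zp)"
    using assms h by (simp add: mahler_series_def)
  ultimately show ?thesis using that by blast
qed

text \<open>
  For large \<open>k\<close> the summand is small because \<open>n! / k!\<close> is an integer; the remaining finitely many
  summands tend to zero because \<open>n!\<close> does.
\<close>
lemma sum_fact_ratio_tendsto_0:
  fixes b :: "nat \<Rightarrow> 'k"
  assumes "b \<longlonglongrightarrow> 0"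
  shows "(\<lambda>n. \<Sum>k\<le>n. fact n / fact k * b k) \<longlonglongrightarrow> 0"
proof (rule metric_LIMSEQ_I)
  fix e :: real
  assume "0 < e"
  obtain K where K: "\<And>k. K \<le> k \<Longrightarrow> absval (b k) < e / 2"
    using metric_LIMSEQ_D[OF assms, of "e / 2"] \<open>0 < e\<close> unfolding absval_def by auto
  define C where "C = (\<Sum>k<K. absval (b k) / absval (fact k :: 'k))"
  have "(\<lambda>n. absval (fact n :: 'k) * C) \<longlonglongrightarrow> 0"
    using tendsto_mult_right[OF absval_fact_tendsto_0, of C] by simp
  then obtain N where N: "\<And>n. N \<le> n \<Longrightarrow> \<bar>absval (fact n :: 'k) * C\<bar> < e / 2"
    using LIMSEQ_D[of _ 0 "e / 2"] \<open>0 < e\<close> by fastforce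
  have "dist (\<Sum>k\<le>n. fact n / fact k * b k) 0 < e" if n: "N \<le> n" for n
  proof -
    have "absval (fact n / fact k * b k) \<le> e / 2" if "k \<le> n" for k
    proof (cases "k < K")
      case True
      have "absval (b k) / absval (fact k :: 'k) \<le> C"
        unfolding C_def by (rule member_le_sum) (use True in \<open>auto simp: absval_nonneg\<close>)
      then have "absval (fact n :: 'k) * (absval (b k) / absval (fact k :: 'k))
          \<le> absval (fact n :: 'k) * C"
        by (rule mult_left_mono) (rule absval_nonneg)
      then show ?thesis
        using N[OF n] abs_ge_self[of "absval (fact n :: 'k) * C"]
        by (simp only: absval_mult absval_divide times_divide_eq_right times_divide_eq_left)
    next
      case False
      obtain q :: nat where "fact n = fact k * q"
        using fact_dvd[OF \<open>k \<le> n\<close>, where 'a = nat] by (rule dvdE)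
      then have "(of_nat (fact n) :: 'k) = of_nat (fact k) * of_nat q"
        by (simp only: of_nat_mult)
      then have "(fact n :: 'k) / fact k = of_nat q"
        by simp
      then have "absval ((fact n :: 'k) / fact k) \<le> 1"
        using absval_of_nat_le_1[of q] by simp
      then have "absval (fact n / fact k * b k) \<le> 1 * absval (b k)"
        unfolding absval_mult by (rule mult_right_mono[OF _ absval_nonneg])
      then show ?thesis
        using K[of k] False by simp
    qed
    then have "absval (\<Sum>k\<le>n. fact n / fact k * b k) \<le> e / 2"
      by (intro absval_sum_le) (use \<open>0 < e\<close> in auto)
    then show ?thesis
      using \<open>0 < e\<close> by (simp add: absval_def)
  qed
  then show "\<exists>N. \<forall>n\<ge>N. dist (\<Sum>k\<le>n. fact n / fact k * b k) 0 < e" by blast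
qed

text \<open>
  The identity \<open>x * (x - 1 gchoose n) = (n + 1) * (x gchoose (n + 1))\<close> turns the operator into
  \<open>a n \<mapsto> a n - n * a (n - 1)\<close> on Mahler coefficients.
\<close>
lemma mahler_series_S_map:
  fixes a b :: "nat \<Rightarrow> 'k"
  assumes "mahler_series a f" and "x \<in> Zp"
    and a0: "a 0 = b 0" and aSuc: "\<And>n. a (Suc n) = of_nat (Suc n) * a n + b (Suc n)"
  shows "(\<lambda>n. b n * (x gchoose n)) sums S_map f x"
proof -
  have a: "(\<lambda>n. a n * (y gchoose n)) sums f y" if "y \<in> Zp" for y
    using assms(1) that by (simp add: mahler_series_def)
  have "x * (a n * (x - 1 gchoose n)) = a n * (of_nat (Suc n) * (x gchoose Suc n))" for n
    by (simp only: gbinomial_absorption mult_ac)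
  then have "x * (a n * (x - 1 gchoose n)) = (a (Suc n) - b (Suc n)) * (x gchoose Suc n)" for n
    by (simp add: aSuc mult_ac)
  then have "(\<lambda>n. (a (Suc n) - b (Suc n)) * (x gchoose Suc n)) sums (x * f (x - 1))"
    using sums_mult_absval[OF a[OF Zp_minus_1[OF assms(2)]], of x] by simp
  then have "(\<lambda>n. (a n - b n) * (x gchoose n)) sums (x * f (x - 1))"
    using sums_Suc_absval[of "\<lambda>n. (a n - b n) * (x gchoose n)"] by (simp add: a0)
  from sums_diff_absval[OF a[OF assms(2)] this]
  show ?thesis
    using assms(2) by (simp add: S_map_def algebra_simps)
qed

lemma mahler_series_inverse:
  fixes \<psi> :: "'k \<Rightarrow> 'k"
  assumes \<psi>: "\<psi> \<in> CZp" and b: "mahler_series b \<psi>"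
  shows "mahler_series (\<lambda>n. \<Sum>k\<le>n. fact n / fact k * b k) (the_inv_into CZp S_map \<psi>)"
proof -
  define a where "a = (\<lambda>n. \<Sum>k\<le>n. fact n / fact k * b k)"
  have "a \<longlonglongrightarrow> 0"
    unfolding a_def using b by (intro sum_fact_ratio_tendsto_0) (simp add: mahler_series_def)
  then obtain f where f: "f \<in> CZp" "mahler_series a f"
    by (rule mahler_series_exists)
  have "a (Suc n) = of_nat (Suc n) * a n + b (Suc n)" for n
    by (simp add: a_def sum_distrib_left mult_ac del: of_nat_Suc)
  then have "(\<lambda>n. b n * (x gchoose n)) sums S_map f x" if "x \<in> Zp" for x
    using mahler_series_S_map[OF f(2) that, of b] by (simp add: a_def)
  then have "S_map f x = \<psi> x" if "x \<in> Zp" for x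
    using b that sums_unique2 unfolding mahler_series_def by blast
  then have "S_map f = \<psi>"
    by (rule CZp_ext[OF S_map_in_CZp[OF f(1)] \<psi>])
  then have "the_inv_into CZp S_map \<psi> = f"
    using the_inv_into_f_f[OF inj_on_S_map f(1)] by simp
  then show ?thesis
    using f(2) by (simp add: a_def)
qed

end

theorem theorem2p4:
  fixes p :: nat
  assumes "prime p"
    and "is_Cp p TYPE('k::{field_char_0,metric_space})"
  shows "CZp_automorphism (S_map :: ('k \<Rightarrow> 'k) \<Rightarrow> ('k \<Rightarrow> 'k)) \<and>
    (\<forall>(\<psi> :: 'k \<Rightarrow> 'k) b. \<psi> \<in> CZp \<and> mahler_series b \<psi> \<longrightarrow>
       mahler_series (\<lambda>n. \<Sum>k\<le>n. fact n / fact k * b k) (the_inv_into CZp S_map \<psi>))"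
proof -
  interpret padic_field "TYPE('k)" p
    using assms by unfold_locales (simp_all add: is_Cp_def)
  show ?thesis
    using S_map_automorphism mahler_series_inverse by blast
qed

end
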